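(* For every positive integer $n$, the set $B_{n+1}(132,321)$ is in bijection with $S_n(132,321)$; in particular $|B_{n+1}(132,321)|=|S_n(132,321)|$.
   Context: A permutation $\sigma\in S_n$ is written as $\sigma(1)\cdots\sigma(n)$. An index $i\in[n-1]$ is an ascent if $\sigma(i)<\sigma(i+1)$ and a descent if $\sigma(i)>\sigma(i+1)$. A ballot permutation is a permutation such that every prefix $\sigma(1)\cdots\sigma(p)$ has at least as many ascents as descents. $\sigma$ contains a pattern $\pi\in S_k$ if some subsequence $\sigma(c_1)\cdots\sigma(c_k)$ with $c_1<\dots<c_k$ is order-isomorphic to $\pi$, and avoids $\pi$ otherwise. $S_n(\pi_1,\dots,\pi_m)$ denotes the set of permutations of $[n]$ avoiding all of $\pi_1,\dots,\pi_m$, and $B_n(\pi_1,\dots,\pi_m)$ the set of ballot permutations of length $n$ avoiding all of them. *)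

theory Defs
  imports "HOL-Combinatorics.Multiset_Permutations" "HOL-Library.Sublist"
begin

text \<open>
  A permutation of \<open>{1..n}\<close> is represented by its one-line notation, the list
  \<open>[\<sigma>(1), \<dots>, \<sigma>(n)]\<close>. List positions count from 0, so position \<open>i\<close> below is the index
  \<open>i + 1\<close> in the usual convention.
\<close>

definition perms :: "nat \<Rightarrow> nat list set" where
  "perms n = permutations_of_set {1..n}"

definition ascents :: "nat list \<Rightarrow> nat set" where
  "ascents \<sigma> = {i. Suc i < length \<sigma> \<and> \<sigma> ! i < \<sigma> ! Suc i}"

definition descents :: "nat list \<Rightarrow> nat set" where
  "descents \<sigma> = {i. Suc i < length \<sigma> \<and> \<sigma> ! i > \<sigma> ! Suc i}"

definition ballot :: "nat list \<Rightarrow> bool" where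
  "ballot \<sigma> \<longleftrightarrow> (\<forall>\<tau>. prefix \<tau> \<sigma> \<longrightarrow> card (ascents \<tau>) \<ge> card (descents \<tau>))"

definition order_isomorphic :: "nat list \<Rightarrow> nat list \<Rightarrow> bool" where
  "order_isomorphic xs ys \<longleftrightarrow> length xs = length ys \<and>
     (\<forall>i < length xs. \<forall>j < length xs. xs ! i < xs ! j \<longleftrightarrow> ys ! i < ys ! j)"

definition contains_pattern :: "nat list \<Rightarrow> nat list \<Rightarrow> bool" where
  "contains_pattern \<sigma> \<pi> \<longleftrightarrow> (\<exists>\<tau>. subseq \<tau> \<sigma> \<and> order_isomorphic \<tau> \<pi>)"

definition avoiding_perms :: "nat \<Rightarrow> nat list set \<Rightarrow> nat list set" where
  "avoiding_perms n P = {\<sigma> \<in> perms n. \<forall>\<pi>\<in>P. \<not> contains_pattern \<sigma> \<pi>}"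

definition avoiding_ballot_perms :: "nat \<Rightarrow> nat list set \<Rightarrow> nat list set" where
  "avoiding_ballot_perms n P = {\<sigma> \<in> avoiding_perms n P. ballot \<sigma>}"

end

theory Submission
  imports Defs
begin

text \<open>
  Let \<open>\<sigma> = L @ [m] @ R\<close> avoid 132 and 321, where \<open>m\<close> is the largest entry. Avoiding 132 puts every
  entry of \<open>L\<close> above every entry of \<open>R\<close>, and avoiding 321 makes \<open>R\<close> increasing, and also \<open>L\<close> as
  soon as \<open>R\<close> is nonempty. So either \<open>\<sigma>\<close> ends in \<open>m\<close>, or \<open>\<sigma>\<close> is one of the \<open>m - 1\<close> nontrivial
  rotations of the identity. Appending the maximum preserves ballotness in both directions, and
  exactly one of these rotations, \<open>m 1 2 \<dots> (m - 1)\<close>, is not ballot. Hence the two cardinalities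
  satisfy the same recurrence up to a shift by one.
\<close>

definition rotated_identity :: "nat \<Rightarrow> nat \<Rightarrow> nat list" where
  "rotated_identity m k = [Suc k..<Suc m] @ [1..<Suc k]"

section \<open>Pattern avoidance\<close>

lemma perms_iff: "\<sigma> \<in> perms n \<longleftrightarrow> distinct \<sigma> \<and> set \<sigma> = {1..n}"
  by (auto simp: perms_def permutations_of_set_def)

lemma contains_132_iff:
  "contains_pattern \<sigma> [1, 3, 2] \<longleftrightarrow> (\<exists>a b c. subseq [a, b, c] \<sigma> \<and> a < c \<and> c < b)"
proof -
  have iso: "order_isomorphic \<tau> [1, 3, 2] \<longleftrightarrow> (\<exists>a b c. \<tau> = [a, b, c] \<and> a < c \<and> c < b)" for \<tau>
  proof (cases "length \<tau> = 3")
    case True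
    then obtain a b c where "\<tau> = [a, b, c]"
      by (auto simp: numeral_eq_Suc length_Suc_conv)
    then show ?thesis
      by (auto simp: order_isomorphic_def less_Suc_eq)
  qed (auto simp: order_isomorphic_def)
  show ?thesis
    unfolding contains_pattern_def iso by blast
qed

lemma contains_321_iff:
  "contains_pattern \<sigma> [3, 2, 1] \<longleftrightarrow> (\<exists>a b c. subseq [a, b, c] \<sigma> \<and> c < b \<and> b < a)"
proof -
  have iso: "order_isomorphic \<tau> [3, 2, 1] \<longleftrightarrow> (\<exists>a b c. \<tau> = [a, b, c] \<and> c < b \<and> b < a)" for \<tau>
  proof (cases "length \<tau> = 3")
    case True
    then obtain a b c where "\<tau> = [a, b, c]"
      by (auto simp: numeral_eq_Suc length_Suc_conv)
    then show ?thesis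
      by (auto simp: order_isomorphic_def less_Suc_eq)
  qed (auto simp: order_isomorphic_def)
  show ?thesis
    unfolding contains_pattern_def iso by blast
qed

text \<open>Working form of avoidance: from here on only inequalities within three-entry
  subsequences matter, and order isomorphism does not appear again.\<close>

lemma avoiding_iff:
  "\<sigma> \<in> avoiding_perms n {[1, 3, 2], [3, 2, 1]} \<longleftrightarrow>
     distinct \<sigma> \<and> set \<sigma> = {1..n} \<and>
     (\<forall>a b c. subseq [a, b, c] \<sigma> \<longrightarrow> \<not> (a < c \<and> c < b) \<and> \<not> (c < b \<and> b < a))"
  unfolding avoiding_perms_def mem_Collect_eq ball_simps perms_iff contains_132_iff contains_321_iff
  by blast

lemma subseq_set_subset: "subseq xs ys \<Longrightarrow> set xs \<subseteq> set ys"
  by (metis set_nths_subset subseq_conv_nths)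

lemma subseq_sorted:
  assumes "subseq xs ys" "sorted ys"
  shows "sorted xs"
  using assms by (metis sorted_nths subseq_conv_nths)

text \<open>Shaped for use with avoidance: a decreasing pair inside a block, extended by one entry
  outside it, becomes a forbidden triple.\<close>

lemma sorted_if_subseq_pairs:
  assumes "\<And>a b. subseq [a, b] xs \<Longrightarrow> a \<le> b"
  shows "sorted xs"
  using assms
proof (induction xs)
  case (Cons x xs)
  have "x \<le> y" if "y \<in> set xs" for y
    using that Cons.prems[of x y] by (simp add: subseq_singleton_left)
  moreover have "sorted xs"
    using Cons by (meson list_emb_Cons)
  ultimately show ?case by simp
qed simp

text \<open>Neither pattern ends in its largest letter, so a maximal final entry cannot take part in
  an occurrence.\<close>

lemma avoiding_snoc_iff:
  "\<tau> @ [Suc n] \<in> avoiding_perms (Suc n) {[1, 3, 2], [3, 2, 1]} \<longleftrightarrow>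
     \<tau> \<in> avoiding_perms n {[1, 3, 2], [3, 2, 1]}"
proof
  assume "\<tau> @ [Suc n] \<in> avoiding_perms (Suc n) {[1, 3, 2], [3, 2, 1]}"
  then have dist: "distinct (\<tau> @ [Suc n])" and set: "set (\<tau> @ [Suc n]) = {1..Suc n}"
    and avoid: "\<And>a b c. subseq [a, b, c] (\<tau> @ [Suc n]) \<Longrightarrow>
      \<not> (a < c \<and> c < b) \<and> \<not> (c < b \<and> b < a)"
    unfolding avoiding_iff by blast+
  have "set \<tau> = set (\<tau> @ [Suc n]) - {Suc n}"
    using dist by auto
  also have "\<dots> = {1..n}"
    unfolding set by auto
  finally have "set \<tau> = {1..n}" .
  moreover have "distinct \<tau>" using dist by simp
  ultimately show "\<tau> \<in> avoiding_perms n {[1, 3, 2], [3, 2, 1]}"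
    unfolding avoiding_iff using avoid[OF subseq_rev_drop_many] by blast
next
  assume "\<tau> \<in> avoiding_perms n {[1, 3, 2], [3, 2, 1]}"
  then have dist: "distinct \<tau>" and set: "set \<tau> = {1..n}"
    and avoid: "\<And>a b c. subseq [a, b, c] \<tau> \<Longrightarrow> \<not> (a < c \<and> c < b) \<and> \<not> (c < b \<and> b < a)"
    unfolding avoiding_iff by blast+
  have "\<not> (a < c \<and> c < b) \<and> \<not> (c < b \<and> b < a)" if "subseq [a, b, c] (\<tau> @ [Suc n])" for a b c
  proof (cases "c = Suc n")
    case True
    have "{a, b, c} \<subseteq> {1..Suc n}"
      using subseq_set_subset[OF that] set by auto
    then show ?thesis using True by auto
  next
    case False
    then have "subseq [a, b, c] \<tau>"
      using that by (auto simp: subseq_append_iff Cons_eq_append_conv split: if_splits)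
    then show ?thesis by (rule avoid)
  qed
  moreover have "set (\<tau> @ [Suc n]) = {1..Suc n}" "distinct (\<tau> @ [Suc n])"
    using dist set by auto
  ultimately show "\<tau> @ [Suc n] \<in> avoiding_perms (Suc n) {[1, 3, 2], [3, 2, 1]}"
    unfolding avoiding_iff by blast
qed

text \<open>A triple splits into entries \<open>us\<close> of the upper block followed by entries
  \<open>vs\<close> of the lower one. Both parts increase and \<open>us\<close> lies above
  \<open>vs\<close>, so the triple has shape 123, 231 or 312.\<close>

lemma rotated_identity_avoiding:
  assumes "k \<le> m"
  shows "rotated_identity m k \<in> avoiding_perms m {[1, 3, 2], [3, 2, 1]}"
proof -
  have "\<not> (a < c \<and> c < b) \<and> \<not> (c < b \<and> b < a)"
    if abc: "subseq [a, b, c] (rotated_identity m k)" for a b c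
  proof -
    obtain us vs where uv: "[a, b, c] = us @ vs" and
      us: "subseq us [Suc k..<Suc m]" and vs: "subseq vs [1..<Suc k]"
      using abc unfolding rotated_identity_def subseq_append_iff by blast
    have "sorted us" "sorted vs"
      using subseq_sorted[OF us sorted_upt] subseq_sorted[OF vs sorted_upt] .
    moreover have "\<forall>x\<in>set us. k < x" "\<forall>x\<in>set vs. x \<le> k"
      using subseq_set_subset[OF us] subseq_set_subset[OF vs] by auto
    ultimately show ?thesis
      using uv by (auto simp: Cons_eq_append_conv)
  qed
  moreover have "distinct (rotated_identity m k)" "set (rotated_identity m k) = {1..m}"
    using assms by (auto simp: rotated_identity_def)
  ultimately show ?thesis
    unfolding avoiding_iff by blast
qed

lemma avoiding_cases:
  assumes "\<sigma> \<in> avoiding_perms (Suc n) {[1, 3, 2], [3, 2, 1]}"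
  obtains (snoc) \<tau> where "\<sigma> = \<tau> @ [Suc n]"
    | (rotated) k where "1 \<le> k" "k \<le> n" "\<sigma> = rotated_identity (Suc n) k"
proof -
  have dist: "distinct \<sigma>" and set: "set \<sigma> = {1..Suc n}"
    and avoid: "\<And>a b c. subseq [a, b, c] \<sigma> \<Longrightarrow> \<not> (a < c \<and> c < b) \<and> \<not> (c < b \<and> b < a)"
    using assms by (simp_all only: avoiding_iff) blast
  obtain L R where \<sigma>: "\<sigma> = L @ Suc n # R"
    using set split_list[of "Suc n" \<sigma>] by auto
  have bound: "x \<le> n" if "x \<in> set L \<union> set R" for x
  proof -
    have "x \<in> {1..Suc n}" "x \<noteq> Suc n" using that dist set unfolding \<sigma> by auto
    then show ?thesis by auto
  qed
  show thesis
  proof (cases "R = []")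
    case True
    then show thesis using \<sigma> snoc by simp
  next
    case False
    \<comment> \<open>If x < y, then x, n+1, y would form a 132.\<close>
    have RL: "y < x" if "x \<in> set L" "y \<in> set R" for x y
    proof -
      have "subseq ([x] @ [Suc n, y]) (L @ Suc n # R)"
        by (rule list_emb_append_mono) (use that in \<open>auto simp: subseq_singleton_left\<close>)
      then have "\<not> x < y" using avoid[of x "Suc n" y] bound[of y] that \<sigma> by auto
      moreover have "x \<noteq> y" using that dist \<sigma> by auto
      ultimately show ?thesis by simp
    qed
    \<comment> \<open>A decreasing pair in \<open>R\<close> would form a 321 with the n+1 before
      it.\<close>
    have R: "sorted R"
    proof (rule sorted_if_subseq_pairs)
      fix a b assume ab: "subseq [a, b] R"
      then have "subseq ([] @ [Suc n, a, b]) (L @ Suc n # R)"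
        by (intro list_emb_append_mono[of _ "[]"]) auto
      moreover have "a \<in> set R" using subseq_set_subset[OF ab] by simp
      ultimately show "a \<le> b" using avoid[of "Suc n" a b] bound[of a] \<sigma> by auto
    qed
    \<comment> \<open>Any entry of \<open>R\<close> lies below all of \<open>L\<close>, so it would
      complete a decreasing pair of \<open>L\<close> to a 321.\<close>
    obtain y where y: "y \<in> set R" using False by (cases R) auto
    have L: "sorted L"
    proof (rule sorted_if_subseq_pairs)
      fix a b assume ab: "subseq [a, b] L"
      then have "subseq ([a, b] @ [y]) (L @ Suc n # R)"
        by (rule list_emb_append_mono) (use y in \<open>auto simp: subseq_singleton_left\<close>)
      moreover have "b \<in> set L" using subseq_set_subset[OF ab] by simp
      ultimately show "a \<le> b" using avoid[of a b y] RL[of b y] y \<sigma> by auto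
    qed
    \<comment> \<open>Moving \<open>R\<close> to the front undoes the rotation: the result is
      increasing with the right entries, hence the identity. Cutting the identity after
      \<open>length R\<close> entries then recovers both blocks.\<close>
    have "sorted (R @ L @ [Suc n])"
      using L R RL bound by (fastforce simp: sorted_append)
    moreover have "distinct (R @ L @ [Suc n])" using dist \<sigma> by auto
    moreover have "set (R @ L @ [Suc n]) = set [1..<Suc (Suc n)]"
    proof -
      have "set (R @ L @ [Suc n]) = set \<sigma>" unfolding \<sigma> by auto
      also have "\<dots> = set [1..<Suc (Suc n)]"
        unfolding set set_upt by (rule atLeastLessThanSuc_atLeastAtMost[symmetric])
      finally show ?thesis .
    qed
    ultimately have id: "R @ L @ [Suc n] = [1..<Suc (Suc n)]"
      by (intro sorted_distinct_set_unique sorted_upt distinct_upt)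
    define k where "k = length R"
    have len: "length R + length L = n"
      using arg_cong[OF id, of length] by simp
    have "R = take k [1..<Suc (Suc n)]" "L @ [Suc n] = drop k [1..<Suc (Suc n)]"
      unfolding id[symmetric] k_def by simp_all
    moreover have "take k [1..<Suc (Suc n)] = [1..<Suc k]"
      using len by (subst take_upt) (auto simp: k_def)
    ultimately have "\<sigma> = rotated_identity (Suc n) k"
      using \<sigma> unfolding rotated_identity_def by (simp del: upt_Suc)
    moreover have "1 \<le> k" "k \<le> n" using len False by (auto simp: k_def Suc_le_eq)
    ultimately show thesis using rotated by blast
  qed
qed

lemma avoiding_Suc:
  "avoiding_perms (Suc n) {[1, 3, 2], [3, 2, 1]} =
     (\<lambda>\<tau>. \<tau> @ [Suc n]) ` avoiding_perms n {[1, 3, 2], [3, 2, 1]} \<union>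
     rotated_identity (Suc n) ` {1..n}"
  (is "?A = ?B")
proof
  show "?A \<subseteq> ?B"
  proof
    fix \<sigma> assume \<sigma>: "\<sigma> \<in> ?A"
    then show "\<sigma> \<in> ?B"
      by (cases rule: avoiding_cases) (use \<sigma> in \<open>auto simp: avoiding_snoc_iff simp del: One_nat_def\<close>)
  qed
  show "?B \<subseteq> ?A"
    by (auto simp: avoiding_snoc_iff rotated_identity_avoiding simp del: One_nat_def)
qed

section \<open>The ballot condition\<close>

lemma finite_ascents: "finite (ascents \<sigma>)"
  by (rule finite_subset[of _ "{..<length \<sigma>}"]) (auto simp: ascents_def)

lemma finite_descents: "finite (descents \<sigma>)"
  by (rule finite_subset[of _ "{..<length \<sigma>}"]) (auto simp: descents_def)

lemma ballot_Nil: "ballot []"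
  by (simp add: ballot_def ascents_def descents_def)

text \<open>The only new prefix is the whole word. Compared with \<open>\<tau>\<close>, itself a
  prefix, it has no fewer ascents and no more descents, so it adds no condition.\<close>

lemma ballot_snoc_iff:
  assumes "\<forall>x\<in>set \<tau>. x < m"
  shows "ballot (\<tau> @ [m]) \<longleftrightarrow> ballot \<tau>"
proof -
  have "ascents \<tau> \<subseteq> ascents (\<tau> @ [m])"
    by (auto simp: ascents_def nth_append)
  then have "card (ascents \<tau>) \<le> card (ascents (\<tau> @ [m]))"
    by (rule card_mono[OF finite_ascents])
  moreover have "descents (\<tau> @ [m]) \<subseteq> descents \<tau>"
  proof
    fix i assume i: "i \<in> descents (\<tau> @ [m])"
    \<comment> \<open>The junction of \<open>\<tau>\<close> with the maximum m is never a
      descent.\<close>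
    have "Suc i \<noteq> length \<tau>"
    proof
      assume "Suc i = length \<tau>"
      moreover from this have "\<tau> ! i < m" using assms by simp
      ultimately show False using i by (auto simp: descents_def nth_append)
    qed
    then show "i \<in> descents \<tau>" using i by (auto simp: descents_def nth_append split: if_splits)
  qed
  then have "card (descents (\<tau> @ [m])) \<le> card (descents \<tau>)"
    by (rule card_mono[OF finite_descents])
  ultimately show ?thesis
    unfolding ballot_def prefix_snoc by fastforce
qed

text \<open>The only descent is at the junction of the two blocks. As k < n, the upper block has at
  least two entries, so an ascent at the very start compensates for it.\<close>

lemma ballot_rotated_identity:
  assumes "1 \<le> k" "k < n"
  shows "ballot (rotated_identity (Suc n) k)"
  unfolding ballot_def
proof (intro allI impI)
  fix \<tau> assume \<tau>: "prefix \<tau> (rotated_identity (Suc n) k)"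
  have len: "length \<tau> \<le> Suc n"
    using prefix_length_le[OF \<tau>] assms by (simp add: rotated_identity_def)
  \<comment> \<open>Counting from 0, the upper block fills positions 0 to n - k, and the entry 1
    stands at position n - k + 1.\<close>
  have nth: "\<tau> ! i = (if i \<le> n - k then Suc k + i else i - (n - k))" if "i < length \<tau>" for i
  proof -
    have "\<tau> ! i = rotated_identity (Suc n) k ! i"
      using \<tau> that by (metis prefix_def nth_append)
    also have "\<dots> = (if i \<le> n - k then Suc k + i else i - (n - k))"
    proof (cases "i \<le> n - k")
      case True
      moreover from this have "i < Suc n - k" using assms by linarith
      ultimately show ?thesis
        by (simp add: rotated_identity_def nth_append del: upt_Suc)
    next
      case False
      then have "\<not> i < Suc n - k" "1 + (i - (Suc n - k)) = i - (n - k)" "i - (Suc n - k) < k"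
        using assms len that by linarith+
      with False show ?thesis
        by (simp add: rotated_identity_def nth_append del: upt_Suc)
    qed
    finally show ?thesis .
  qed
  have desc: "descents \<tau> \<subseteq> {n - k}"
  proof
    fix i assume "i \<in> descents \<tau>"
    then have "Suc i < length \<tau>" "\<tau> ! Suc i < \<tau> ! i" by (simp_all add: descents_def)
    then show "i \<in> {n - k}" using nth[of i] nth[of "Suc i"] by (simp split: if_splits)
  qed
  show "card (descents \<tau>) \<le> card (ascents \<tau>)"
  proof (cases "descents \<tau> = {}")
    case False
    then have "n - k \<in> descents \<tau>" using desc by auto
    \<comment> \<open>A prefix showing the descent contains the whole upper block, hence its initial
      ascent.\<close>
    then have len1: "1 < length \<tau>" using assms by (simp add: descents_def)
    then have "\<tau> ! 0 < \<tau> ! Suc 0" using assms nth[of 0] nth[of 1]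
      by (cases \<tau>) auto
    then have "0 \<in> ascents \<tau>" using len1 by (simp add: ascents_def)
    then have "1 \<le> card (ascents \<tau>)"
      using finite_ascents[of \<tau>] by (auto simp: Suc_le_eq card_gt_0_iff)
    moreover have "card (descents \<tau>) \<le> 1" using card_mono[OF _ desc] by simp
    ultimately show ?thesis by simp
  qed simp
qed

lemma not_ballot_Cons_Cons:
  assumes "y < x"
  shows "\<not> ballot (x # y # zs)"
proof -
  have "ascents [x, y] = {}" "descents [x, y] = {0}"
    using assms by (auto simp: ascents_def descents_def)
  then have "\<not> card (descents [x, y]) \<le> card (ascents [x, y])" by simp
  moreover have "prefix [x, y] (x # y # zs)" by simp
  ultimately show ?thesis unfolding ballot_def by blast
qed

lemma ballot_rotated_identity_iff:
  assumes "1 \<le> k" "k \<le> n"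
  shows "ballot (rotated_identity (Suc n) k) \<longleftrightarrow> k < n"
proof (cases "k = n")
  case True
  \<comment> \<open>For k = n the upper block is the single entry n+1, so the word opens with a
    descent.\<close>
  have "rotated_identity (Suc n) n = Suc n # 1 # [2..<Suc n]"
    using assms by (simp add: rotated_identity_def upt_conv_Cons numeral_2_eq_2 del: upt_Suc)
  then show ?thesis using True assms by (simp add: not_ballot_Cons_Cons del: upt_Suc)
next
  case False
  then show ?thesis using assms ballot_rotated_identity by simp
qed

lemma avoiding_ballot_Suc:
  "avoiding_ballot_perms (Suc n) {[1, 3, 2], [3, 2, 1]} =
     (\<lambda>\<tau>. \<tau> @ [Suc n]) ` avoiding_ballot_perms n {[1, 3, 2], [3, 2, 1]} \<union>
     rotated_identity (Suc n) ` {1..<n}"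
proof -
  have "ballot (\<tau> @ [Suc n]) \<longleftrightarrow> ballot \<tau>"
    if "\<tau> \<in> avoiding_perms n {[1, 3, 2], [3, 2, 1]}" for \<tau>
    using that by (intro ballot_snoc_iff) (auto simp: avoiding_perms_def perms_iff)
  then have "avoiding_ballot_perms (Suc n) {[1, 3, 2], [3, 2, 1]} =
      (\<lambda>\<tau>. \<tau> @ [Suc n]) ` avoiding_ballot_perms n {[1, 3, 2], [3, 2, 1]} \<union>
      rotated_identity (Suc n) ` {k \<in> {1..n}. ballot (rotated_identity (Suc n) k)}"
    unfolding avoiding_ballot_perms_def avoiding_Suc by blast
  also have "{k \<in> {1..n}. ballot (rotated_identity (Suc n) k)} = {1..<n}"
    by (auto simp: ballot_rotated_identity_iff)
  finally show ?thesis .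
qed

section \<open>Counting\<close>

lemma finite_avoiding: "finite (avoiding_perms n P)"
  by (rule finite_subset[of _ "perms n"]) (auto simp: avoiding_perms_def perms_def)

lemma finite_avoiding_ballot: "finite (avoiding_ballot_perms n P)"
  by (rule finite_subset[OF _ finite_avoiding[of n P]]) (auto simp: avoiding_ballot_perms_def)

text \<open>The last entry tells all cases apart: the rotation with index k ends in k, which is at
  most n, while the other words end in n+1. Leaving \<open>K\<close> general serves both
  counts.\<close>

lemma card_snoc_Un_rotated:
  assumes "finite T" "K \<subseteq> {1..n}"
  shows "card ((\<lambda>\<tau>. \<tau> @ [Suc n]) ` T \<union> rotated_identity (Suc n) ` K) = card T + card K"
proof -
  have last: "last (rotated_identity (Suc n) k) = k" if "k \<in> K" for k
    using that assms by (auto simp: rotated_identity_def last_append)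
  have "inj_on (rotated_identity (Suc n)) K"
    by (rule inj_on_inverseI[of _ last]) (rule last)
  moreover have "\<tau> @ [Suc n] \<noteq> rotated_identity (Suc n) k" if "k \<in> K" for \<tau> k
  proof
    assume "\<tau> @ [Suc n] = rotated_identity (Suc n) k"
    then have "Suc n = k" using last[OF that] by (metis last_snoc)
    then show False using that assms by auto
  qed
  then have "(\<lambda>\<tau>. \<tau> @ [Suc n]) ` T \<inter> rotated_identity (Suc n) ` K = {}" by blast
  moreover have "finite K" using assms finite_subset by blast
  moreover have "inj_on (\<lambda>\<tau>. \<tau> @ [Suc n]) T" by (simp add: inj_on_def)
  ultimately show ?thesis
    using assms by (simp add: card_Un_disjoint card_image)
qed

lemma card_avoiding_Suc:
  "card (avoiding_perms (Suc n) {[1, 3, 2], [3, 2, 1]}) =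
     card (avoiding_perms n {[1, 3, 2], [3, 2, 1]}) + n"
  unfolding avoiding_Suc by (subst card_snoc_Un_rotated) (auto simp: finite_avoiding)

text \<open>Truncated subtraction makes this valid at n = 0 too, which the base case below
  uses.\<close>

lemma card_avoiding_ballot_Suc:
  "card (avoiding_ballot_perms (Suc n) {[1, 3, 2], [3, 2, 1]}) =
     card (avoiding_ballot_perms n {[1, 3, 2], [3, 2, 1]}) + (n - 1)"
  unfolding avoiding_ballot_Suc
  by (subst card_snoc_Un_rotated) (auto simp: finite_avoiding_ballot)

text \<open>Passing from n to n+1 adds n on both sides: on the left the index is one higher, which
  offsets the missing rotation.\<close>

lemma card_avoiding_ballot_eq:
  "card (avoiding_ballot_perms (Suc n) {[1, 3, 2], [3, 2, 1]}) =
     card (avoiding_perms n {[1, 3, 2], [3, 2, 1]})"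
proof (induction n)
  case 0
  \<comment> \<open>At length 0 at most the empty word occurs, and it is ballot; the increment from
    length 0 to 1 is 0.\<close>
  have "avoiding_perms 0 P \<subseteq> {[]}" for P
    by (auto simp: avoiding_perms_def perms_def)
  then have "avoiding_ballot_perms 0 P = avoiding_perms 0 P" for P
    unfolding avoiding_ballot_perms_def using ballot_Nil by blast
  then show ?case using card_avoiding_ballot_Suc[of 0] by simp
next
  case (Suc n)
  then show ?case
    using card_avoiding_ballot_Suc[of "Suc n"] card_avoiding_Suc[of n] by simp
qed

theorem theorem3p10:
  fixes n :: nat
  assumes "n \<ge> 1"
  shows "(\<exists>f. bij_betw f (avoiding_ballot_perms (n + 1) {[1, 3, 2], [3, 2, 1]})
                          (avoiding_perms n {[1, 3, 2], [3, 2, 1]}))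
       \<and> card (avoiding_ballot_perms (n + 1) {[1, 3, 2], [3, 2, 1]})
         = card (avoiding_perms n {[1, 3, 2], [3, 2, 1]})"
proof -
  have "card (avoiding_ballot_perms (n + 1) {[1, 3, 2], [3, 2, 1]})
      = card (avoiding_perms n {[1, 3, 2], [3, 2, 1]})"
    using card_avoiding_ballot_eq by simp
  \<comment> \<open>The bijection is not explicit; it comes from equal finite cardinalities.\<close>
  then show ?thesis
    using finite_same_card_bij[OF finite_avoiding_ballot finite_avoiding] by blast
qed

end
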